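(* Let $\Gamma=(V,E)$ be a simple connected graph with vertex set $V=\{1,\ldots,n\}$, and let $\mathcal{Z}_\Gamma$ be its graphical zonotope. Then the $f$-polynomial of $\mathcal{Z}_\Gamma$ is given by $$f(\mathcal{Z}_\Gamma,q)=(-1)^{|V|}\chi_{-q}(\Gamma,-1),$$ where $\chi_{-q}(\Gamma,-1)$ denotes the polynomial $\chi_q(\Gamma,d)$ (defined below) with $q$ replaced by $-q$ and $d$ replaced by $-1$.
   Context: The graphical zonotope of $\Gamma$ is the Minkowski sum $\mathcal{Z}_\Gamma=\sum_{\{i,j\}\in E,\ i<j}[-(e_i-e_j),\,e_i-e_j]\subset\mathbb{R}^n$, where $e_1,\ldots,e_n$ is the standard basis; for connected $\Gamma$ it has dimension $n-1$. The $f$-polynomial of an $m$-dimensional polytope $P$ is $f(P,q)=\sum_{i=0}^{m}f_i(P)q^i$, where $f_i(P)$ is the number of $i$-dimensional faces of $P$. For $I\subseteq V$, $\Gamma|_I$ is the induced subgraph on $I$, and its rank $\mathrm{rk}(\Gamma|_I)$ is the number of edges of a spanning forest of $\Gamma|_I$, i.e. $|I|$ minus the number of connected components of $\Gamma|_I$. The $q$-chromatic polynomial is the polynomial in $d$ (with coefficients polynomials in $q$) $$\chi_q(\Gamma,d)=\sum_{k=1}^{n}\binom{d}{k}\sum_{(I_1,\ldots,I_k)}q^{\mathrm{rk}(\Gamma|_{I_1})+\cdots+\mathrm{rk}(\Gamma|_{I_k})},\qquad \binom{d}{k}=\frac{d(d-1)\cdots(d-k+1)}{k!},$$ where the inner sum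 is over all ordered set partitions $(I_1,\ldots,I_k)$ of $V$ into $k$ nonempty blocks. Equivalently, $\chi_q(\Gamma,d)$ is the principal specialization $x_1=\cdots=x_d=1$, $x_{d+1}=x_{d+2}=\cdots=0$ of the $q$-chromatic symmetric function $\Psi_q(\Gamma)=\sum_{\alpha=(a_1,\ldots,a_k)\models n}\Big(\sum q^{\mathrm{rk}(\Gamma|_{I_1})+\cdots+\mathrm{rk}(\Gamma|_{I_k})}\Big)M_\alpha$, the inner sum being over ordered set partitions $(I_1,\ldots,I_k)$ of $V$ with $|I_j|=a_j$, and $M_\alpha$ the monomial quasisymmetric functions. At $q=0$ this is the usual chromatic polynomial. *)

theory Defs
  imports
    "HOL-Analysis.Analysis"
    "HOL-Computational_Algebra.Polynomial"
    "Graph_Theory.Digraph_Component"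
begin

(* Undirected simple graphs are the graphs of Graph_Theory: finite symmetric digraphs
   without loops and multiple arcs, an edge {i, j} being the pair of arcs (i, j), (j, i). *)

(* The vertex type 'n, finite and linearly ordered, plays the role of {1, ..., n},
   and axis i 1 is the standard basis vector e_i of R^n.
   The outer sum is the Minkowski sum of sets from HOL-Library.Set_Algebras. *)
definition graphical_zonotope :: "('n::{finite,linorder}, 'b) pre_digraph \<Rightarrow> (real ^ ('n::{finite,linorder})) set" where
  "graphical_zonotope G =
    (\<Sum>(i, j)\<in>{(i, j). (i, j) \<in> arcs_ends G \<and> i < j}.
       closed_segment (- (axis i 1 - axis j 1)) (axis i 1 - axis j 1))"

definition f_number :: "'a::euclidean_space set \<Rightarrow> nat \<Rightarrow> nat" where
  "f_number P i = card {F. F face_of P \<and> aff_dim F = int i}"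

definition f_polynomial :: "'a::euclidean_space set \<Rightarrow> real poly" where
  "f_polynomial P = (\<Sum>i=0..nat (aff_dim P). monom (of_nat (f_number P i)) i)"

definition connected_components :: "('a, 'b) pre_digraph \<Rightarrow> ('a, 'b) pre_digraph set" where
  "connected_components H =
    {C. pre_digraph.max_subgraph H Digraph_Component.connected C}"

definition graph_rank :: "('a, 'b) pre_digraph \<Rightarrow> nat" where
  "graph_rank H = card (verts H) - card (connected_components H)"

definition ordered_set_partitions :: "'a set \<Rightarrow> nat \<Rightarrow> 'a set list set" where
  "ordered_set_partitions V k =
    {Is. length Is = k \<and> distinct Is \<and> partition_on V (set Is)}"

(* A real poly poly is a polynomial in d with coefficients in R[q]. *)

definition binomial_poly :: "nat \<Rightarrow> real poly poly" where
  "binomial_poly k = smult [:1 / fact k:] (\<Prod>i<k. [:- of_nat i, 1:])"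

definition q_chromatic_poly :: "('a, 'b) pre_digraph \<Rightarrow> real poly poly" where
  "q_chromatic_poly G =
    (\<Sum>k=1..card (verts G).
       smult (\<Sum>Is\<in>ordered_set_partitions (verts G) k.
                monom 1 (\<Sum>I\<leftarrow>Is. graph_rank (G \<restriction> I)))
             (binomial_poly k))"

end

theory Submission
  imports Defs
begin

text \<open>
  The nonempty faces of the zonotope are the sets of maximizers of linear functionals $w$, and the
  face of $w$ only depends on the signs of $w_i - w_j$ on the edges. Its dimension is $n$ minus the
  number of components of the graph of tied edges, those with $w_i = w_j$. An ordered set partition
  gives the functional that maps a vertex to the index of its block, and its total rank is the
  dimension of the corresponding face. It therefore suffices that the partitions $(I_1, \ldots, I_k)$
  belonging to a given face satisfy $\sum (-1)^k = (-1)^c$, where $c$ is the number of tie components: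
  the first block of such a partition is the union of a nonempty set of minimal tie components,
  so this follows by induction on $c$ from $\sum_{T \neq \emptyset} (-1)^{|T|} = -1$.
\<close>

subsection \<open>Signed count of ordered set partitions\<close>

text \<open>The number of blocks is left free, so that removing the first block gives a recursion
  within one family.\<close>

definition set_compositions :: "'a set \<Rightarrow> 'a set list set" where
  "set_compositions U = {Is. distinct Is \<and> partition_on U (set Is)}"

text \<open>Putting a block in front shifts the values of all later blocks by one, so their
  differences, which are all that matters, survive removal of the first block. A point in no block
  gets the length of the list.\<close>

primrec block_index :: "'a set list \<Rightarrow> 'a \<Rightarrow> nat" where
  "block_index [] x = 0"
| "block_index (S # Is) x = (if x \<in> S then 0 else Suc (block_index Is x))"

text \<open>For the arcs of the graph, this is the relation of cutting out the same face of the
  zonotope; see \<open>graphical_face_eq_iff\<close>.\<close>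

definition same_signs :: "('a \<times> 'a) set \<Rightarrow> ('a \<Rightarrow> real) \<Rightarrow> ('a \<Rightarrow> real) \<Rightarrow> bool" where
  "same_signs E w w' \<longleftrightarrow> (\<forall>(x, y)\<in>E. sgn (w x - w y) = sgn (w' x - w' y))"

definition tied :: "('a \<times> 'a) set \<Rightarrow> ('a \<Rightarrow> real) \<Rightarrow> ('a \<times> 'a) set" where
  "tied E w = {(x, y) \<in> E. w x = w y}"

text \<open>Only the edges inside \<open>U\<close> are tested, since after removal of a first block
  \<open>S\<close> the recursion continues on \<open>U - S\<close>.\<close>

definition compat_compositions :: "('a \<times> 'a) set \<Rightarrow> ('a \<Rightarrow> real) \<Rightarrow> 'a set \<Rightarrow> 'a set list set" where
  "compat_compositions E w U =
    {Is \<in> set_compositions U. same_signs (Restr E U) (real \<circ> block_index Is) w}"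

section \<open>Ordered set partitions, block by block\<close>

lemma set_compositions_empty [simp]: "set_compositions {} = {[]}"
  by (auto simp: set_compositions_def partition_on_def) (metis list.set_intros(1) neq_Nil_conv)

lemma Nil_in_set_compositions_iff [simp]: "[] \<in> set_compositions U \<longleftrightarrow> U = {}"
  by (auto simp: set_compositions_def partition_on_def)

lemma Cons_in_set_compositions_iff:
  "S # Is \<in> set_compositions U \<longleftrightarrow> S \<noteq> {} \<and> S \<subseteq> U \<and> Is \<in> set_compositions (U - S)"
proof
  assume "S # Is \<in> set_compositions U"
  then have *: "distinct Is" "S \<notin> set Is" "\<Union>(insert S (set Is)) = U" "disjoint (insert S (set Is))"
      "{} \<notin> insert S (set Is)"
    unfolding set_compositions_def partition_on_def by simp_all
  have "S \<inter> T = {}" if "T \<in> set Is" for T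
    using *(2,4) that by (metis disjointD insertCI)
  then have "\<Union>(set Is) = U - S" using *(3) by blast
  moreover have "disjoint (set Is)"
    using *(4) by (rule pairwise_subset) auto
  ultimately show "S \<noteq> {} \<and> S \<subseteq> U \<and> Is \<in> set_compositions (U - S)"
    unfolding set_compositions_def partition_on_def using * by blast
next
  assume *: "S \<noteq> {} \<and> S \<subseteq> U \<and> Is \<in> set_compositions (U - S)"
  then have **: "distinct Is" "\<Union>(set Is) = U - S" "disjoint (set Is)" "{} \<notin> set Is"
    unfolding set_compositions_def partition_on_def by simp_all
  then have "S \<notin> set Is" using * by blast
  moreover have "S \<inter> T = {}" if "T \<in> set Is" for T
    using **(2) that by blast
  then have "disjoint (insert S (set Is))"
    using **(3) by (auto simp: pairwise_insert disjnt_def Int_commute)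
  moreover have "\<Union>(insert S (set Is)) = U" using * **(2) by blast
  ultimately show "S # Is \<in> set_compositions U"
    unfolding set_compositions_def partition_on_def using * ** by auto
qed

lemma length_set_composition_le:
  assumes "finite U" "Is \<in> set_compositions U"
  shows "length Is \<le> card U"
  using assms
proof (induction Is arbitrary: U)
  case (Cons S Is)
  then have S: "S \<noteq> {}" "S \<subseteq> U" "Is \<in> set_compositions (U - S)"
    by (auto simp: Cons_in_set_compositions_iff)
  then have "length Is \<le> card (U - S)" using Cons by auto
  also have "\<dots> < card U" using S Cons.prems by (intro psubset_card_mono) auto
  finally show ?case by simp
qed simp

lemma finite_set_compositions:
  assumes "finite U"
  shows "finite (set_compositions U)"
proof (rule finite_subset)
  show "set_compositions U \<subseteq> {Is. set Is \<subseteq> Pow U \<and> length Is \<le> card U}"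
    using length_set_composition_le[OF assms] by (auto simp: set_compositions_def partition_on_def)
  show "finite {Is. set Is \<subseteq> Pow U \<and> length Is \<le> card U}"
    using assms by (intro finite_lists_length_le) auto
qed

lemma finite_compat_compositions: "finite U \<Longrightarrow> finite (compat_compositions E w U)"
  by (simp add: compat_compositions_def finite_set_compositions)

text \<open>The points of \<open>S\<close> have index 0, all others a positive index, and a common
  shift by one does not change the signs among the others. Symmetry of \<open>E\<close> lets the
  condition on edges from \<open>S\<close> to \<open>U - S\<close> also settle the edges in the
  opposite direction.\<close>

lemma Cons_in_compat_compositions_iff:
  assumes "sym E"
  shows "S # Is \<in> compat_compositions E w U \<longleftrightarrow>
    S \<noteq> {} \<and> S \<subseteq> U \<and> Is \<in> compat_compositions E w (U - S) \<and>
    (\<forall>(x, y)\<in>E. x \<in> S \<longrightarrow> y \<in> S \<longrightarrow> w x = w y) \<and>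
    (\<forall>(x, y)\<in>E. x \<in> S \<longrightarrow> y \<in> U - S \<longrightarrow> w x < w y)"
    (is "?L \<longleftrightarrow> ?R")
proof (cases "S \<noteq> {} \<and> S \<subseteq> U \<and> Is \<in> set_compositions (U - S)")
  case False
  then show ?thesis by (auto simp: compat_compositions_def Cons_in_set_compositions_iff)
next
  case True
  let ?b = "block_index Is"
  have sgn_Suc: "sgn (real (Suc a) - real (Suc b)) = sgn (real a - real b)" for a b by simp
  have "same_signs (Restr E U) (real \<circ> block_index (S # Is)) w \<longleftrightarrow>
    same_signs (Restr E (U - S)) (real \<circ> ?b) w \<and>
    (\<forall>(x, y)\<in>E. x \<in> S \<longrightarrow> y \<in> S \<longrightarrow> w x = w y) \<and>
    (\<forall>(x, y)\<in>E. x \<in> S \<longrightarrow> y \<in> U - S \<longrightarrow> w x < w y)" (is "?l \<longleftrightarrow> ?r")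
  proof
    assume l: ?l
    have *: "sgn (real (block_index (S # Is) x) - real (block_index (S # Is) y)) = sgn (w x - w y)"
      if "(x, y) \<in> E" "x \<in> U" "y \<in> U" for x y
      using l that by (auto simp: same_signs_def simp del: block_index.simps)
    show ?r
      unfolding same_signs_def
    proof (intro conjI; clarify)
      fix x y assume "(x, y) \<in> E" "x \<in> U" "x \<notin> S" "y \<in> U" "y \<notin> S"
      then show "sgn ((real \<circ> ?b) x - (real \<circ> ?b) y) = sgn (w x - w y)"
        using *[of x y] by simp
    next
      fix x y assume xy: "(x, y) \<in> E" "x \<in> S" "y \<in> S"
      then have "sgn (w x - w y) = 0" using *[of x y] True by auto
      then show "w x = w y" by (simp add: sgn_0_0)
    next
      fix x y assume "(x, y) \<in> E" "x \<in> S" "y \<in> U" "y \<notin> S"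
      then have "sgn (w x - w y) = -1" using *[of x y] True by auto
      then show "w x < w y" by (simp add: sgn_1_neg)
    qed
  next
    assume r: ?r
    show ?l
      unfolding same_signs_def
    proof clarify
      fix x y assume xy: "(x, y) \<in> E" "x \<in> U" "y \<in> U"
      then have yx: "(y, x) \<in> E" using assms by (auto dest: symD)
      consider "x \<in> S" "y \<in> S" | "x \<in> S" "y \<notin> S" | "x \<notin> S" "y \<in> S" | "x \<notin> S" "y \<notin> S" by blast
      then show "sgn ((real \<circ> block_index (S # Is)) x - (real \<circ> block_index (S # Is)) y) = sgn (w x - w y)"
      proof cases
        case 1
        then show ?thesis using r xy by fastforce
      next
        case 2
        then have "w x < w y" using r xy by fastforce
        then show ?thesis using 2 by simp
      next
        case 3
        then have "w y < w x" using r xy yx by fastforce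
        then show ?thesis using 3 by simp
      next
        case 4
        then show ?thesis using r xy by (auto simp: same_signs_def)
      qed
    qed
  qed
  then show ?thesis using True by (auto simp: compat_compositions_def Cons_in_set_compositions_iff)
qed

text \<open>Fix \<open>a\<close> in \<open>A\<close>. The subsets avoiding \<open>a\<close> pair off
  with the subsets containing it, and the two terms of each pair cancel.\<close>

lemma sum_Pow_minus_one_power_card:
  assumes "finite A" "A \<noteq> {}"
  shows "(\<Sum>T\<in>Pow A. (-1) ^ card T) = (0 :: 'a::comm_ring_1)"
proof -
  obtain a where a: "a \<in> A" using assms by auto
  have "(\<Sum>T\<in>Pow A. (-1) ^ card T) =
      (\<Sum>T\<in>Pow (A - {a}) \<union> insert a ` Pow (A - {a}). (-1 :: 'a) ^ card T)"
    using a by (metis Pow_insert insert_Diff)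
  also have "\<dots> = (\<Sum>T\<in>Pow (A - {a}). (-1) ^ card T) + (\<Sum>T\<in>insert a ` Pow (A - {a}). (-1) ^ card T)"
    using assms by (intro sum.union_disjoint) auto
  also have "(\<Sum>T\<in>insert a ` Pow (A - {a}). (-1 :: 'a) ^ card T) =
      (\<Sum>T\<in>Pow (A - {a}). (-1) ^ card (insert a T))"
    by (intro sum.reindex_cong[of "insert a"]) (auto simp: inj_on_def)
  also have "\<dots> = (\<Sum>T\<in>Pow (A - {a}). - ((-1) ^ card T))"
  proof (rule sum.cong)
    fix T assume T: "T \<in> Pow (A - {a})"
    then have "finite T" using assms finite_subset by auto
    then show "(-1 :: 'a) ^ card (insert a T) = - ((-1) ^ card T)" using T by (subst card_insert_disjoint) auto
  qed simp
  finally show ?thesis by (simp add: sum_negf)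
qed

lemma sum_Cons_image_UN:
  fixes f :: "'a list \<Rightarrow> 'b::comm_monoid_add"
  assumes "finite F" "\<And>S. S \<in> F \<Longrightarrow> finite (C S)"
  shows "sum f (\<Union>S\<in>F. Cons S ` C S) = (\<Sum>S\<in>F. \<Sum>Is\<in>C S. f (S # Is))"
proof -
  have "sum f (\<Union>S\<in>F. Cons S ` C S) = (\<Sum>S\<in>F. sum f (Cons S ` C S))"
    using assms by (intro sum.UNION_disjoint) auto
  then show ?thesis by (simp add: sum.reindex inj_on_def)
qed

section \<open>Tie classes and the signed count\<close>

lemma tied_rtrancl_eq: "(x, y) \<in> (tied E w)\<^sup>* \<Longrightarrow> w x = w y"
  by (induction rule: rtrancl_induct) (auto simp: tied_def)

lemma sym_tied: "sym E \<Longrightarrow> sym (tied E w)"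
  by (auto simp: sym_def tied_def)

lemma equiv_rtrancl: "sym r \<Longrightarrow> equiv UNIV (r\<^sup>*)"
  by (intro equivI refl_rtrancl sym_rtrancl trans_rtrancl) auto

lemma in_quotient_Image_eq:
  assumes "equiv UNIV r" "C \<in> UNIV // r" "x \<in> C"
  shows "C = r `` {x}"
  using assms by (metis Image_singleton_iff equiv_class_eq_iff quotientE)

lemma first_blocks_eq:
  fixes w :: "'a \<Rightarrow> real"
  assumes "sym E" and Q: "Q \<subseteq> UNIV // (tied E w)\<^sup>*"
  defines "U \<equiv> \<Union>Q"
  defines "M \<equiv> {C \<in> Q. \<forall>x\<in>C. \<forall>y\<in>U. (x, y) \<in> E \<longrightarrow> w x \<le> w y}"
  shows "{S. S \<noteq> {} \<and> S \<subseteq> U \<and> (\<forall>(x, y)\<in>E. x \<in> S \<longrightarrow> y \<in> S \<longrightarrow> w x = w y) \<and>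
      (\<forall>(x, y)\<in>E. x \<in> S \<longrightarrow> y \<in> U - S \<longrightarrow> w x < w y)} = Union ` (Pow M - {{}})"
    (is "?F = _")
proof (intro equalityI subsetI)
  have equiv: "equiv UNIV ((tied E w)\<^sup>*)"
    by (rule equiv_rtrancl[OF sym_tied[OF \<open>sym E\<close>]])
  fix S
  {
    assume S: "S \<in> ?F"
    have sat: "C \<subseteq> S" if C: "C \<in> Q" "C \<inter> S \<noteq> {}" for C
    proof
      fix y assume "y \<in> C"
      obtain x where x: "x \<in> C" "x \<in> S" using C by auto
      have "C = (tied E w)\<^sup>* `` {x}"
        using C x Q by (intro in_quotient_Image_eq[OF equiv]) auto
      with \<open>y \<in> C\<close> have "(x, y) \<in> (tied E w)\<^sup>*" by auto
      then show "y \<in> S"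
      proof (induction rule: rtrancl_induct)
        case (step y z)
        then have "(x, z) \<in> (tied E w)\<^sup>*" by auto
        \<comment> \<open>As \<open>z\<close> lies in \<open>U\<close>, being outside
          \<open>S\<close> would make the edge from \<open>y\<close> to \<open>z\<close> strictly
          increasing, contrary to the tie.\<close>
        then have "z \<in> U" using \<open>C = _\<close> C by (auto simp: U_def)
        then show ?case using step S by (fastforce simp: tied_def)
      qed (rule x)
    qed
    define T where "T = {C \<in> Q. C \<inter> S \<noteq> {}}"
    have "T \<subseteq> M"
    proof
      fix C assume "C \<in> T"
      then have "C \<in> {C \<in> Q. C \<inter> S \<noteq> {}}" by (simp add: T_def)
      moreover from this have "C \<subseteq> S" using sat by auto
      ultimately show "C \<in> M" using S unfolding M_def by (force)
    qed
    moreover have "S = \<Union>T"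
      unfolding T_def
    proof (intro equalityI subsetI)
      fix x assume "x \<in> S"
      moreover have "x \<in> \<Union>Q" using \<open>x \<in> S\<close> S unfolding U_def by blast
      then obtain C where "C \<in> Q" "x \<in> C" by blast
      ultimately show "x \<in> \<Union>{C \<in> Q. C \<inter> S \<noteq> {}}" by blast
    qed (use sat in blast)
    moreover from this have "T \<noteq> {}" using S by auto
    ultimately show "S \<in> Union ` (Pow M - {{}})" by simp
  next
    assume "S \<in> Union ` (Pow M - {{}})"
    then obtain T where T: "T \<subseteq> M" "T \<noteq> {}" "S = \<Union>T" by auto
    then have sub: "S \<subseteq> U" by (auto simp: M_def U_def)
    have le: "w x \<le> w y" if "(x, y) \<in> E" "x \<in> S" "y \<in> U" for x y
      using T that by (auto simp: M_def)
    obtain C where C: "C \<in> T" using T by auto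
    then have "C \<noteq> {}" using T Q equiv by (metis (no_types, lifting) M_def in_quotient_imp_non_empty mem_Collect_eq subset_eq)
    with C T have ne: "S \<noteq> {}" by auto
    have eq: "w x = w y" if "(x, y) \<in> E" "x \<in> S" "y \<in> S" for x y
      using le[of x y] le[of y x] that sub symD[OF \<open>sym E\<close>, of x y] by (metis antisym subsetD)
    have less: "w x < w y" if "(x, y) \<in> E" "x \<in> S" "y \<in> U - S" for x y
    proof (rule ccontr)
      assume "\<not> w x < w y"
      then have "(x, y) \<in> tied E w" using le[of x y] that by (auto simp: tied_def)
      moreover have "x \<in> \<Union>T" using that(2) T(3) by simp
      then obtain C where C: "C \<in> T" "x \<in> C" by blast
      then have "C = (tied E w)\<^sup>* `` {x}"
        using T Q by (intro in_quotient_Image_eq[OF equiv]) (auto simp: M_def)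
      ultimately have "y \<in> C" by auto
      with C T that show False by auto
    qed
    show "S \<in> ?F" using ne sub eq less by blast
  }
qed

text \<open>\<open>Q\<close> may be any finite set of tie classes, because the points left over by a
  first block are again the union of such a set, namely a smaller one. The tie relation itself stays
  that of the whole of \<open>E\<close> throughout the induction.\<close>

theorem signed_count_compat_compositions:
  fixes w :: "'a \<Rightarrow> real"
  assumes E: "sym E" and "finite Q" "finite (\<Union>Q)" and Q: "Q \<subseteq> UNIV // (tied E w)\<^sup>*"
  shows "(\<Sum>Is\<in>compat_compositions E w (\<Union>Q). (-1) ^ length Is) = ((-1) ^ card Q :: 'b::comm_ring_1)"
  using assms(2-)
proof (induction Q rule: finite_psubset_induct)
  case (psubset Q)
  note fin = \<open>finite Q\<close> \<open>finite (\<Union>Q)\<close> and Q = \<open>Q \<subseteq> _\<close>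
  have equiv: "equiv UNIV ((tied E w)\<^sup>*)"
    by (rule equiv_rtrancl[OF sym_tied[OF \<open>sym E\<close>]])
  have ne: "C \<noteq> {}" if "C \<in> Q" for C
    using Q that equiv in_quotient_imp_non_empty by blast
  have disj: "C \<inter> D = {}" if "C \<in> Q" "D \<in> Q" "C \<noteq> D" for C D
    using Q that equiv quotient_disj by blast
  show ?case
  proof (cases "Q = {}")
    case True
    then show ?thesis by (simp add: compat_compositions_def same_signs_def)
  next
    case False
    let ?U = "\<Union>Q"
    define M where "M = {C \<in> Q. \<forall>x\<in>C. \<forall>y\<in>?U. (x, y) \<in> E \<longrightarrow> w x \<le> w y}"
    define F where "F = {S. S \<noteq> {} \<and> S \<subseteq> ?U \<and> (\<forall>(x, y)\<in>E. x \<in> S \<longrightarrow> y \<in> S \<longrightarrow> w x = w y) \<and>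
      (\<forall>(x, y)\<in>E. x \<in> S \<longrightarrow> y \<in> ?U - S \<longrightarrow> w x < w y)}"
    have F: "F = Union ` (Pow M - {{}})"
      unfolding F_def M_def by (rule first_blocks_eq[OF E Q])
    have "M \<subseteq> Q" by (auto simp: M_def)
    then have "finite M" using fin finite_subset by auto
    have "?U \<noteq> {}" using False ne by auto
    \<comment> \<open>The class of a point minimizing \<open>w\<close> on the union is minimal,
      since \<open>w\<close> is constant on each class.\<close>
    have "M \<noteq> {}"
    proof -
      obtain x where x: "x \<in> ?U" "\<And>y. y \<in> ?U \<Longrightarrow> w x \<le> w y"
        using \<open>?U \<noteq> {}\<close> fin by (metis (no_types, lifting) arg_min_if_finite(1) arg_min_least)
      then obtain C where C: "C \<in> Q" "x \<in> C" by auto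
      then have "C = (tied E w)\<^sup>* `` {x}"
        using Q by (intro in_quotient_Image_eq[OF equiv]) auto
      then have "w z = w x" if "z \<in> C" for z using tied_rtrancl_eq[of x z E w] that by auto
      then have "C \<in> M" unfolding M_def using C(1) x(2) by fastforce
      then show ?thesis by auto
    qed
    \<comment> \<open>The classes are nonempty and pairwise disjoint, so a union of classes
      determines which classes were used.\<close>
    have inj: "inj_on Union (Pow M)"
    proof (rule inj_onI)
      have "C \<in> T'" if T: "T \<in> Pow M" "T' \<in> Pow M" "\<Union>T = \<Union>T'" and C: "C \<in> T" for T T' C
      proof -
        have "C \<in> Q" using C T(1) \<open>M \<subseteq> Q\<close> by auto
        then obtain x where "x \<in> C" using ne[of C] by auto
        then have "x \<in> \<Union>T'" using C T(3) by blast
        then obtain D where "D \<in> T'" "x \<in> D" by blast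
        moreover have "D \<in> Q" using T(2) \<open>D \<in> T'\<close> \<open>M \<subseteq> Q\<close> by auto
        ultimately have "C = D" using disj[of C D] \<open>C \<in> Q\<close> \<open>x \<in> C\<close> by auto
        with \<open>D \<in> T'\<close> show ?thesis by simp
      qed
      then show "T = T'" if "T \<in> Pow M" "T' \<in> Pow M" "\<Union>T = \<Union>T'" for T T'
        using that by (intro equalityI subsetI) metis+
    qed
    have "[] \<notin> compat_compositions E w ?U"
      using \<open>?U \<noteq> {}\<close> by (simp add: compat_compositions_def)
    then have "compat_compositions E w ?U = (\<Union>S\<in>F. Cons S ` compat_compositions E w (?U - S))"
    proof (intro equalityI subsetI)
      fix Is assume "Is \<in> compat_compositions E w ?U" "[] \<notin> compat_compositions E w ?U"
      then obtain S Js where "Is = S # Js" by (metis list.exhaust)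
      with \<open>Is \<in> _\<close> have "S \<in> F" "Js \<in> compat_compositions E w (?U - S)"
        unfolding F_def by (simp_all add: Cons_in_compat_compositions_iff[OF E])
      with \<open>Is = S # Js\<close> show "Is \<in> (\<Union>S\<in>F. Cons S ` compat_compositions E w (?U - S))"
        by blast
    qed (auto simp: F_def Cons_in_compat_compositions_iff[OF E])
    moreover have "finite F" using F \<open>finite M\<close> by simp
    ultimately have "(\<Sum>Is\<in>compat_compositions E w ?U. (-1 :: 'b) ^ length Is) =
        (\<Sum>S\<in>F. \<Sum>Is\<in>compat_compositions E w (?U - S). (-1) ^ length (S # Is))"
      using fin by (simp add: sum_Cons_image_UN finite_compat_compositions)
    \<comment> \<open>Dropping the first block changes the parity of the length.\<close>
    also have "\<dots> = (\<Sum>S\<in>F. - (\<Sum>Is\<in>compat_compositions E w (?U - S). (-1) ^ length Is))"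
      by (simp add: sum_negf)
    also have "\<dots> = (\<Sum>T\<in>Pow M - {{}}. - (\<Sum>Is\<in>compat_compositions E w (?U - \<Union>T). (-1) ^ length Is))"
      unfolding F by (rule sum.reindex_cong[OF inj_on_subset[OF inj]]) auto
    \<comment> \<open>The induction hypothesis applies to \<open>Q - T\<close>. Its sign is written
      as a product to separate the dependence on \<open>T\<close>; a difference and a sum of
      cardinalities have the same parity.\<close>
    also have "\<dots> = (\<Sum>T\<in>Pow M - {{}}. - ((-1) ^ card Q * (-1) ^ card T))"
    proof (rule sum.cong)
      fix T assume T: "T \<in> Pow M - {{}}"
      then have TQ: "T \<subseteq> Q" using \<open>M \<subseteq> Q\<close> by auto
      then have "finite T" using fin finite_subset by auto
      have "?U - \<Union>T = \<Union>(Q - T)" using disj TQ by blast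
      moreover have "(\<Sum>Is\<in>compat_compositions E w (\<Union>(Q - T)). (-1) ^ length Is) = (-1 :: 'b) ^ card (Q - T)"
        using T TQ Q fin by (intro psubset.IH) (auto intro: finite_subset)
      moreover have "(-1 :: 'b) ^ card Q * (-1) ^ card T = (-1) ^ card (Q - T)"
      proof -
        have "card Q = card (Q - T) + card T"
          using TQ fin \<open>finite T\<close> by (simp add: card_Diff_subset card_mono)
        then have "(-1 :: 'b) ^ card Q * (-1) ^ card T = (-1) ^ card (Q - T) * ((-1) ^ card T * (-1) ^ card T)"
          by (simp add: power_add mult.assoc)
        then show ?thesis by (simp flip: power_mult_distrib)
      qed
      ultimately show "- (\<Sum>Is\<in>compat_compositions E w (?U - \<Union>T). (-1 :: 'b) ^ length Is) =
          - ((-1) ^ card Q * (-1) ^ card T)"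
        by simp
    qed simp
    also have "\<dots> = - ((-1) ^ card Q) * (\<Sum>T\<in>Pow M - {{}}. (-1) ^ card T)"
      by (simp add: sum_distrib_left sum_negf)
    \<comment> \<open>The sum over all subsets vanishes, and the empty set contributes 1 to
      it.\<close>
    also have "(\<Sum>T\<in>Pow M - {{}}. (-1 :: 'b) ^ card T) = - 1"
      using sum_Pow_minus_one_power_card[OF \<open>finite M\<close> \<open>M \<noteq> {}\<close>, where 'a = 'b] \<open>finite M\<close>
      by (subst sum_diff) auto
    finally show ?thesis by simp
  qed
qed

subsection \<open>Components and ranks\<close>

lemma (in wf_digraph) strongly_connected_imp_connected:
  "strongly_connected G \<Longrightarrow> Digraph_Component.connected G"
  by (intro connectedI) (auto simp: strongly_connected_def intro: reachable_mk_symmetricI)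

text \<open>Adding arcs on the same vertices preserves connectedness. This is what makes a maximal
  connected subgraph an induced one.\<close>

lemma (in wf_digraph) arc_mono_connected: "arc_mono Digraph_Component.connected"
  unfolding arc_mono_def
proof (intro allI impI; elim conjE)
  fix H1 H2 :: "('x, 'y) pre_digraph"
  assume *: "Digraph_Component.connected H1" "subgraph H1 H2" "verts H1 = verts H2"
  then interpret H2: wf_digraph H2 by auto
  show "Digraph_Component.connected H2"
    using * by (intro H2.connected_spanning_imp_connected[of H1]) (auto simp: spanning_def)
qed

text \<open>With symmetric arcs, connected induced subgraphs are strongly connected. What remains is
  to compare two kinds of maximality, one among all subgraphs and the other among the vertex sets of
  induced subgraphs. The result makes the vertex sets of strong components available for counting
  components.\<close>

lemma (in sym_digraph) connected_components_eq_sccs: "connected_components G = sccs"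
proof (intro equalityI subsetI)
  fix C assume "C \<in> connected_components G"
  then have max: "max_subgraph Digraph_Component.connected C"
    by (simp add: connected_components_def)
  then have ind: "induced_subgraph C G"
    using arc_mono_connected by (rule induced_subgraphI_arc_mono)
  interpret C: wf_digraph C using wf_digraphI_induced[OF ind] .
  have "strongly_connected C"
    by (rule C.symmetric_connected_imp_strongly_connected[OF
        induced_graph_imp_symmetric[OF sym_arcs ind] max_subgraph_prop[OF max]])
  moreover have False
    if D: "induced_subgraph D G" "strongly_connected D" "verts C \<subset> verts D" for D
  proof -
    interpret D: wf_digraph D using wf_digraphI_induced[OF D(1)] .
    \<comment> \<open>Both are induced subgraphs, so inclusion of the vertex sets already gives
      inclusion of the arcs.\<close>
    have "subgraph C D"
      unfolding subgraph_def
    proof (intro conjI)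
      have "arcs C = {e \<in> arcs G. tail G e \<in> verts C \<and> head G e \<in> verts C}"
        "arcs D = {e \<in> arcs G. tail G e \<in> verts D \<and> head G e \<in> verts D}"
        using ind D(1) unfolding induced_subgraph_def by blast+
      then show "arcs C \<subseteq> arcs D" using D(3) by blast
      have "compatible G C" "compatible G D"
        using ind D(1) unfolding induced_subgraph_def subgraph_def by blast+
      then show "compatible D C" unfolding compatible_def by simp
      show "verts C \<subseteq> verts D" using D(3) by blast
    qed (fact C.wf_digraph D.wf_digraph)+
    moreover have "subgraph D G" using D(1) by (rule induced_imp_subgraph)
    ultimately show False
      using max D.strongly_connected_imp_connected[OF D(2)] D(3) by (auto simp: max_subgraph_def)
  qed
  ultimately show "C \<in> sccs" using ind by auto
next
  fix C assume C: "C \<in> sccs"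
  then have ind: "induced_subgraph C G" by (rule in_sccs_imp_induced)
  interpret C: wf_digraph C using wf_digraphI_induced[OF ind] .
  have "max_subgraph Digraph_Component.connected C"
  proof (rule max_subgraphI)
    show "Digraph_Component.connected C"
      using C by (intro C.strongly_connected_imp_connected) auto
    show "subgraph C G" using ind by (rule induced_imp_subgraph)
  next
    fix D assume D: "C \<noteq> D" "subgraph C D" "subgraph D G"
    show "\<not> Digraph_Component.connected D"
    proof
      assume conn: "Digraph_Component.connected D"
      \<comment> \<open>Filling in all arcs between the vertices of \<open>D\<close> keeps it
        connected and makes it comparable with the strong component \<open>C\<close>.\<close>
      let ?D = "G \<restriction> verts D"
      have sub: "subgraph D ?D" using D(3) by (rule subgraph_induce_subgraphI2)
      have ind': "induced_subgraph ?D G" using D(3) by (intro induced_induce) auto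
      interpret D': wf_digraph ?D using wf_digraphI_induced[OF ind'] .
      have "Digraph_Component.connected ?D"
        using sub conn by (intro D'.connected_spanning_imp_connected[of D]) (auto simp: spanning_def)
      then have "strongly_connected ?D"
        by (intro D'.symmetric_connected_imp_strongly_connected induced_graph_imp_symmetric[OF sym_arcs ind'])
      moreover have "verts C \<subseteq> verts ?D" using D(2) by auto
      ultimately have "verts C = verts ?D" using C ind' unfolding sccs_def by blast
      then have "C = ?D" using ind ind' induced_eq_verts_imp_eq by blast
      \<comment> \<open>\<open>D\<close> is squeezed between \<open>C\<close> and \<open>?D\<close>,
        which coincide.\<close>
      with sub D(2) have "arcs C = arcs D" "verts C = verts D"
        unfolding subgraph_def by blast+
      moreover have "tail C = tail D" "head C = head D"
        using D(2) by (auto simp: subgraph_def compatible_def)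
      ultimately show False using D(1) by simp
    qed
  qed
  then show "C \<in> connected_components G" by (simp add: connected_components_def)
qed

lemma block_index_eq_iff:
  assumes "Is \<in> set_compositions U" "x \<in> U" "y \<in> U"
  shows "block_index Is x = block_index Is y \<longleftrightarrow> (\<forall>I\<in>set Is. x \<in> I \<longleftrightarrow> y \<in> I)"
  using assms
proof (induction Is arbitrary: U)
  case (Cons S Is)
  then have S: "S \<subseteq> U" "Is \<in> set_compositions (U - S)"
    by (auto simp: Cons_in_set_compositions_iff)
  then have sub: "I \<inter> S = {}" if "I \<in> set Is" for I
    using that by (auto simp: set_compositions_def partition_on_def)
  show ?case
  proof (cases "x \<in> S \<or> y \<in> S")
    case True
    then show ?thesis using sub by auto
  next
    case False
    then show ?thesis using Cons.IH[OF S(2)] Cons.prems by auto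
  qed
qed simp

text \<open>An edge is tied under the block index exactly when both ends lie in the same block. A
  tied path that starts in \<open>I\<close> therefore never leaves \<open>I\<close> and is a path of
  the induced subgraph; by symmetry, reachability there is mutual.\<close>

lemma (in graph) tied_block_index_class_eq:
  assumes "verts G = UNIV" "Is \<in> set_compositions UNIV" "I \<in> set Is" "u \<in> I"
  defines "r \<equiv> tied (arcs_ends G) (real \<circ> block_index Is)"
  shows "pre_digraph.scc_of (G \<restriction> I) u = r\<^sup>* `` {u}"
proof -
  have ind: "induced_subgraph (G \<restriction> I) G" using assms by (intro induced_induce) auto
  interpret I: sym_digraph "G \<restriction> I" using induced_graph_imp_graph[OF ind] .
  have blk: "y \<in> I \<longleftrightarrow> z \<in> I" if "block_index Is y = block_index Is z" for y z
    using that block_index_eq_iff[OF assms(2)] assms(3) by auto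
  have same: "block_index Is y = block_index Is z" if "y \<in> I" "z \<in> I" for y z
  proof -
    have "y \<in> J \<longleftrightarrow> z \<in> J" if "J \<in> set Is" for J
    proof (cases "J = I")
      case False
      then have "disjnt J I"
        using assms(2,3) that by (auto simp: set_compositions_def partition_on_def pairwise_def)
      then show ?thesis using \<open>y \<in> I\<close> \<open>z \<in> I\<close> by (auto simp: disjnt_def)
    qed (use \<open>y \<in> I\<close> \<open>z \<in> I\<close> in auto)
    then show ?thesis using block_index_eq_iff[OF assms(2)] by auto
  qed
  have sub: "arcs_ends (G \<restriction> I) \<subseteq> r"
    using same by (auto simp: r_def tied_def arcs_ends_conv)
  have "u \<rightarrow>\<^sup>*\<^bsub>G \<restriction> I\<^esub> v \<longleftrightarrow> (u, v) \<in> r\<^sup>*" for v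
  proof
    assume "u \<rightarrow>\<^sup>*\<^bsub>G \<restriction> I\<^esub> v"
    then show "(u, v) \<in> r\<^sup>*"
      using rtrancl_mono[OF sub] by (auto dest: reachable_rtranclI)
  next
    assume "(u, v) \<in> r\<^sup>*"
    then show "u \<rightarrow>\<^sup>*\<^bsub>G \<restriction> I\<^esub> v"
    proof (induction rule: rtrancl_induct)
      case base
      then show ?case using assms(4) by (intro I.reachable_refl) simp
    next
      case (step y z)
      then have "y \<in> I" using I.reachable_in_verts by fastforce
      moreover from this have "z \<in> I" using step(2) blk[of y z] by (simp add: r_def tied_def)
      ultimately have "(y, z) \<in> arcs_ends (G \<restriction> I)"
        using step(2) by (auto simp: r_def tied_def arcs_ends_conv)
      then show ?case using step.IH by (rule I.reachable_adj_trans[rotated])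
    qed
  qed
  then show ?thesis
    unfolding I.scc_of_def by (auto dest: I.symmetric_reachable')
qed

text \<open>The components of the subgraph induced on a block are the tie classes inside that block,
  and every tie class lies in exactly one block. Summing the ranks thus gives the number of vertices
  minus the number of classes, stated additively to avoid truncated subtraction.\<close>

lemma (in graph) sum_graph_rank_add_card:
  assumes V: "verts G = UNIV" and Is: "Is \<in> set_compositions UNIV"
  shows "(\<Sum>I\<leftarrow>Is. graph_rank (G \<restriction> I)) +
    card (UNIV // (tied (arcs_ends G) (real \<circ> block_index Is))\<^sup>*) = card (UNIV :: 'a set)"
proof -
  define r where "r = (tied (arcs_ends G) (real \<circ> block_index Is))\<^sup>*"
  define comps where "comps I = (\<lambda>u. r `` {u}) ` I" for I
  have part: "distinct Is" "\<Union>(set Is) = UNIV" "disjoint (set Is)"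
    using Is unfolding set_compositions_def partition_on_def by simp_all
  have fin: "finite (UNIV :: 'a set)" using finite_verts V by simp
  then have finI: "finite I" for I :: "'a set" by (rule finite_subset[OF subset_UNIV])
  have scc: "comps I = pre_digraph.sccs_verts (G \<restriction> I)" and rank: "graph_rank (G \<restriction> I) = card I - card (comps I)"
    if "I \<in> set Is" for I
  proof -
    have ind: "induced_subgraph (G \<restriction> I) G" using V by (intro induced_induce) auto
    interpret I: sym_digraph "G \<restriction> I" using induced_graph_imp_graph[OF ind] .
    show 1: "comps I = I.sccs_verts"
      unfolding I.sccs_verts_conv_scc_of comps_def r_def
      using tied_block_index_class_eq[OF V Is that] by (intro image_cong) simp_all
    show "graph_rank (G \<restriction> I) = card I - card (comps I)"
      unfolding graph_rank_def 1 I.connected_components_eq_sccs by (simp add: I.card_sccs_verts)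
  qed
  have sub: "\<Union>(comps I) \<subseteq> I" if "I \<in> set Is" for I
  proof -
    have "wf_digraph (G \<restriction> I)" by (rule wellformed_induce_subgraph)
    then show ?thesis
      unfolding scc[OF that] using wf_digraph.sccs_verts_subsets by fastforce
  qed
  have ne: "C \<noteq> {}" if "C \<in> comps I" for C I
    using that by (auto simp: comps_def r_def)
  have "UNIV // r = (\<Union>I\<in>set Is. comps I)"
    using part(2) unfolding quotient_def comps_def by blast
  also have "card \<dots> = (\<Sum>I\<in>set Is. card (comps I))"
  proof (rule card_UN_disjoint)
    show "\<forall>I\<in>set Is. finite (comps I)" using finI by (auto simp: comps_def)
    show "\<forall>I\<in>set Is. \<forall>J\<in>set Is. I \<noteq> J \<longrightarrow> comps I \<inter> comps J = {}"
    proof (intro ballI impI)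
      fix I J assume IJ: "I \<in> set Is" "J \<in> set Is" "I \<noteq> J"
      have "I \<inter> J = {}" using part(3) IJ by (auto dest: disjointD)
      then show "comps I \<inter> comps J = {}" using sub[OF IJ(1)] sub[OF IJ(2)] ne by blast
    qed
  qed simp
  finally have "card (UNIV // r) = (\<Sum>I\<in>set Is. card (comps I))" .
  moreover have "(\<Sum>I\<leftarrow>Is. graph_rank (G \<restriction> I)) = (\<Sum>I\<in>set Is. graph_rank (G \<restriction> I))"
    using part(1) by (rule sum_list_distinct_conv_sum_set)
  \<comment> \<open>A block has at most as many classes as points, so the truncated subtraction in
    \<open>graph_rank\<close> is exact.\<close>
  moreover have "(\<Sum>I\<in>set Is. graph_rank (G \<restriction> I)) + (\<Sum>I\<in>set Is. card (comps I)) = (\<Sum>I\<in>set Is. card I)"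
    unfolding sum.distrib[symmetric]
    using finI by (intro sum.cong) (auto simp: rank comps_def card_image_le)
  moreover have "(\<Sum>I\<in>set Is. card I) = card (UNIV :: 'a set)"
    using card_Union_disjoint[of "set Is"] part finI by (simp add: disjoint_def pairwise_def disjnt_def)
  ultimately show ?thesis by (simp add: r_def)
qed

subsection \<open>Faces of zonotopes\<close>

definition zonotope :: "'i set \<Rightarrow> ('i \<Rightarrow> 'a::euclidean_space) \<Rightarrow> 'a set" where
  "zonotope A v = (\<Sum>e\<in>A. closed_segment (- v e) (v e))"

text \<open>For finite \<open>A\<close> these are the maximizers of \<open>w\<close> on the
  zonotope, as \<open>zonotope_face_eq\<close> shows. Writing them by coefficients exposes their
  dependence on signs alone.\<close>

definition zonotope_face :: "'i set \<Rightarrow> ('i \<Rightarrow> 'a::euclidean_space) \<Rightarrow> 'a \<Rightarrow> 'a set" where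
  "zonotope_face A v w = {\<Sum>e\<in>A. t e *\<^sub>R v e | t.
     \<forall>e\<in>A. \<bar>t e\<bar> \<le> 1 \<and> (w \<bullet> v e \<noteq> 0 \<longrightarrow> t e = sgn (w \<bullet> v e))}"

lemma in_closed_segment_minus_iff:
  fixes a :: "'a::real_vector"
  shows "x \<in> closed_segment (- a) a \<longleftrightarrow> (\<exists>t. \<bar>t\<bar> \<le> 1 \<and> x = t *\<^sub>R a)"
proof
  assume "x \<in> closed_segment (- a) a"
  then obtain u where u: "0 \<le> u" "u \<le> 1" "x = (1 - u) *\<^sub>R (- a) + u *\<^sub>R a"
    by (auto simp: closed_segment_def)
  then have "x = (2 * u - 1) *\<^sub>R a" by (simp add: algebra_simps flip: scaleR_2)
  then show "\<exists>t. \<bar>t\<bar> \<le> 1 \<and> x = t *\<^sub>R a" using u by (intro exI[of _ "2 * u - 1"]) auto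
next
  assume "\<exists>t. \<bar>t\<bar> \<le> 1 \<and> x = t *\<^sub>R a"
  then obtain t where t: "\<bar>t\<bar> \<le> 1" "x = t *\<^sub>R a" by auto
  have "x = (1 - (t + 1) / 2) *\<^sub>R (- a) + ((t + 1) / 2) *\<^sub>R a"
    unfolding t scaleR_minus_right scaleR_minus_left[symmetric] scaleR_left_distrib[symmetric]
    by (simp add: field_simps)
  then show "x \<in> closed_segment (- a) a"
    using t unfolding closed_segment_def by (intro CollectI exI[of _ "(t + 1) / 2"]) auto
qed

lemma zonotope_eq:
  assumes "finite A"
  shows "zonotope A v = {\<Sum>e\<in>A. t e *\<^sub>R v e | t. \<forall>e\<in>A. \<bar>t e\<bar> \<le> 1}"
proof (intro equalityI subsetI)
  fix x assume "x \<in> zonotope A v"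
  then obtain s where s: "x = sum s A" "\<forall>e\<in>A. \<exists>t. \<bar>t\<bar> \<le> 1 \<and> s e = t *\<^sub>R v e"
    by (auto simp: zonotope_def set_sum_alt[OF assms] in_closed_segment_minus_iff)
  from bchoice[OF s(2)] obtain t where "\<forall>e\<in>A. \<bar>t e\<bar> \<le> 1 \<and> s e = t e *\<^sub>R v e" by blast
  then show "x \<in> {\<Sum>e\<in>A. t e *\<^sub>R v e | t. \<forall>e\<in>A. \<bar>t e\<bar> \<le> 1}" using s by auto
next
  fix x assume "x \<in> {\<Sum>e\<in>A. t e *\<^sub>R v e | t. \<forall>e\<in>A. \<bar>t e\<bar> \<le> 1}"
  then show "x \<in> zonotope A v"
    by (auto simp: zonotope_def set_sum_alt[OF assms] in_closed_segment_minus_iff)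
qed

lemma finite_set_sum:
  fixes B :: "'i \<Rightarrow> 'a::comm_monoid_add set"
  shows "finite A \<Longrightarrow> (\<And>e. e \<in> A \<Longrightarrow> finite (B e)) \<Longrightarrow> finite (\<Sum>e\<in>A. B e)"
  by (induction A rule: finite_induct) (auto simp: finite_set_plus set_zero)

text \<open>A Minkowski sum of convex hulls is the convex hull of the Minkowski sum, here of
  finitely many two-point sets.\<close>

lemma polytope_zonotope: "finite A \<Longrightarrow> polytope (zonotope A v)"
  unfolding polytope_def zonotope_def segment_convex_hull convex_hull_set_sum[symmetric]
  using finite_set_sum[of A "\<lambda>e. {- v e, v e}"] by auto

lemma mult_le_abs:
  fixes t a :: real
  assumes "\<bar>t\<bar> \<le> 1"
  shows "t * a \<le> \<bar>a\<bar>"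
  using mult_right_mono[OF assms, of "\<bar>a\<bar>"] abs_ge_self[of "t * a"] by (simp add: abs_mult)

lemma inner_zonotope_le:
  assumes "\<forall>e\<in>A. \<bar>t e\<bar> \<le> 1"
  shows "w \<bullet> (\<Sum>e\<in>A. t e *\<^sub>R v e) \<le> (\<Sum>e\<in>A. \<bar>w \<bullet> v e\<bar>)"
  using assms by (auto simp: inner_sum_right intro!: sum_mono mult_le_abs)

text \<open>The bound holds term by term, so equality of the sums forces equality in every
  term.\<close>

lemma inner_zonotope_eq_iff:
  fixes w :: "'a::euclidean_space"
  assumes "finite A" and t: "\<forall>e\<in>A. \<bar>t e\<bar> \<le> 1"
  shows "w \<bullet> (\<Sum>e\<in>A. t e *\<^sub>R v e) = (\<Sum>e\<in>A. \<bar>w \<bullet> v e\<bar>) \<longleftrightarrow>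
    (\<forall>e\<in>A. w \<bullet> v e \<noteq> 0 \<longrightarrow> t e = sgn (w \<bullet> v e))"
proof -
  have "w \<bullet> (\<Sum>e\<in>A. t e *\<^sub>R v e) = (\<Sum>e\<in>A. \<bar>w \<bullet> v e\<bar>) \<longleftrightarrow>
      (\<Sum>e\<in>A. \<bar>w \<bullet> v e\<bar> - t e * (w \<bullet> v e)) = 0"
    by (auto simp: inner_sum_right sum_subtractf)
  also have "\<dots> \<longleftrightarrow> (\<forall>e\<in>A. \<bar>w \<bullet> v e\<bar> - t e * (w \<bullet> v e) = 0)"
    using assms mult_le_abs by (intro sum_nonneg_eq_0_iff) auto
  also have "\<dots> \<longleftrightarrow> (\<forall>e\<in>A. w \<bullet> v e \<noteq> 0 \<longrightarrow> t e = sgn (w \<bullet> v e))"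
  proof -
    have "\<bar>a\<bar> - s * a = 0 \<longleftrightarrow> (a \<noteq> 0 \<longrightarrow> s = sgn a)" for a s :: real
    proof (cases a "0 :: real" rule: linorder_cases)
      case less
      then have "\<bar>a\<bar> - s * a = 0 \<longleftrightarrow> (- 1) * a = s * a" by auto
      then show ?thesis using less by (simp only: mult_cancel_right) auto
    qed auto
    then show ?thesis by simp
  qed
  finally show ?thesis .
qed

lemma zonotope_face_eq:
  assumes "finite A"
  shows "zonotope_face A v w = zonotope A v \<inter> {x. w \<bullet> x = (\<Sum>e\<in>A. \<bar>w \<bullet> v e\<bar>)}"
proof (intro equalityI subsetI)
  fix x assume "x \<in> zonotope_face A v w"
  then obtain t where "x = (\<Sum>e\<in>A. t e *\<^sub>R v e)" "\<forall>e\<in>A. \<bar>t e\<bar> \<le> 1"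
      "\<forall>e\<in>A. w \<bullet> v e \<noteq> 0 \<longrightarrow> t e = sgn (w \<bullet> v e)"
    by (auto simp: zonotope_face_def)
  then show "x \<in> zonotope A v \<inter> {x. w \<bullet> x = (\<Sum>e\<in>A. \<bar>w \<bullet> v e\<bar>)}"
    using inner_zonotope_eq_iff[OF assms, of t w v] by (auto simp: zonotope_eq[OF assms])
next
  fix x assume x: "x \<in> zonotope A v \<inter> {x. w \<bullet> x = (\<Sum>e\<in>A. \<bar>w \<bullet> v e\<bar>)}"
  then obtain t where t: "x = (\<Sum>e\<in>A. t e *\<^sub>R v e)" "\<forall>e\<in>A. \<bar>t e\<bar> \<le> 1"
    by (auto simp: zonotope_eq[OF assms])
  with x have "\<forall>e\<in>A. w \<bullet> v e \<noteq> 0 \<longrightarrow> t e = sgn (w \<bullet> v e)"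
    using inner_zonotope_eq_iff[OF assms t(2), of w v] by auto
  with t show "x \<in> zonotope_face A v w" by (auto simp: zonotope_face_def)
qed

text \<open>The free coefficients are set to 0, which gives the center of the face. This point shows
  that the face is nonempty, attains the maximum of \<open>w\<close>, and later recovers the signs
  and serves as origin.\<close>

lemma center_in_zonotope_face: "(\<Sum>e\<in>A. sgn (w \<bullet> v e) *\<^sub>R v e) \<in> zonotope_face A v w"
  unfolding zonotope_face_def by (intro CollectI exI[of _ "\<lambda>e. sgn (w \<bullet> v e)"]) (simp add: abs_sgn_eq)

text \<open>All faces of a polyhedron are exposed, so a nonempty face is cut out by a supporting
  hyperplane. Its offset \<open>b\<close> must be the maximum of \<open>w\<close>: a point of the
  face gives one inequality and the center of \<open>zonotope_face A v w\<close> the other.\<close>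

lemma faces_of_zonotope:
  assumes A: "finite A"
  shows "{F. F face_of zonotope A v \<and> F \<noteq> {}} = range (zonotope_face A v)"
proof (intro equalityI subsetI)
  have le: "w \<bullet> x \<le> (\<Sum>e\<in>A. \<bar>w \<bullet> v e\<bar>)" if "x \<in> zonotope A v" for w x
    using that inner_zonotope_le by (auto simp: zonotope_eq[OF A])
  {
    fix F assume "F \<in> {F. F face_of zonotope A v \<and> F \<noteq> {}}"
    then have "F exposed_face_of zonotope A v" and ne: "F \<noteq> {}"
      using exposed_face_of_polyhedron[OF polytope_imp_polyhedron[OF polytope_zonotope[OF A]]] by auto
    then obtain w b where wb: "zonotope A v \<subseteq> {x. w \<bullet> x \<le> b}" "F = zonotope A v \<inter> {x. w \<bullet> x = b}"
      by (auto simp: exposed_face_of_def)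
    obtain x where "x \<in> F" using ne by auto
    then have "b \<le> (\<Sum>e\<in>A. \<bar>w \<bullet> v e\<bar>)" using le wb by auto
    moreover have "(\<Sum>e\<in>A. \<bar>w \<bullet> v e\<bar>) \<le> b"
      using center_in_zonotope_face[where A = A and w = w and v = v] wb(1)
      unfolding zonotope_face_eq[OF A] by auto
    ultimately have "F = zonotope_face A v w" using wb(2) by (simp add: zonotope_face_eq[OF A])
    then show "F \<in> range (zonotope_face A v)" by simp
  next
    fix F assume "F \<in> range (zonotope_face A v)"
    then obtain w where w: "F = zonotope_face A v w" by auto
    have "F face_of zonotope A v"
      unfolding w zonotope_face_eq[OF A]
      by (intro face_of_Int_supporting_hyperplane_le polytope_imp_convex polytope_zonotope A le)
    moreover have "F \<noteq> {}" using center_in_zonotope_face w by blast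
    ultimately show "F \<in> {F. F face_of zonotope A v \<and> F \<noteq> {}}" by simp
  }
qed

text \<open>If the faces of \<open>a\<close> and \<open>b\<close> agree, the center built from the
  signs of \<open>b\<close> maximizes \<open>a\<close>, so the signs agree wherever \<open>a\<close>
  does not vanish. Exchanging the roles covers the places where only \<open>b\<close> is
  nonzero.\<close>

lemma zonotope_face_eq_iff:
  assumes A: "finite A"
  shows "zonotope_face A v w = zonotope_face A v w' \<longleftrightarrow> (\<forall>e\<in>A. sgn (w \<bullet> v e) = sgn (w' \<bullet> v e))"
proof
  assume eq: "zonotope_face A v w = zonotope_face A v w'"
  have *: "sgn (b \<bullet> v e) = sgn (a \<bullet> v e)"
    if "zonotope_face A v a = zonotope_face A v b" "e \<in> A" "a \<bullet> v e \<noteq> 0" for a b e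
  proof -
    have "a \<bullet> (\<Sum>e\<in>A. sgn (b \<bullet> v e) *\<^sub>R v e) = (\<Sum>e\<in>A. \<bar>a \<bullet> v e\<bar>)"
      using center_in_zonotope_face[where A = A and w = b and v = v] that(1) zonotope_face_eq[OF A, of v a] by auto
    then have "\<forall>e\<in>A. a \<bullet> v e \<noteq> 0 \<longrightarrow> sgn (b \<bullet> v e) = sgn (a \<bullet> v e)"
      by (subst (asm) inner_zonotope_eq_iff[OF A]) (simp_all add: abs_sgn_eq)
    then show ?thesis using that(2,3) by simp
  qed
  show "\<forall>e\<in>A. sgn (w \<bullet> v e) = sgn (w' \<bullet> v e)"
  proof
    fix e assume "e \<in> A"
    then show "sgn (w \<bullet> v e) = sgn (w' \<bullet> v e)"
      using *[OF eq, of e] *[OF eq[symmetric], of e] by metis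
  qed
next
  assume "\<forall>e\<in>A. sgn (w \<bullet> v e) = sgn (w' \<bullet> v e)"
  then have "\<forall>e\<in>A. (w \<bullet> v e \<noteq> 0 \<longrightarrow> t e = sgn (w \<bullet> v e)) \<longleftrightarrow> (w' \<bullet> v e \<noteq> 0 \<longrightarrow> t e = sgn (w' \<bullet> v e))" for t
    by (metis sgn_0_0)
  then show "zonotope_face A v w = zonotope_face A v w'"
    unfolding zonotope_face_def by (intro Collect_cong ex_cong1 conj_cong refl) auto
qed

text \<open>Moved so that its center is the origin, the face consists of combinations of the
  generators orthogonal to \<open>w\<close> and contains each of these generators. Hence both sets
  have the same span.\<close>

lemma aff_dim_zonotope_face:
  assumes A: "finite A"
  shows "aff_dim (zonotope_face A v w) = int (dim (v ` {e \<in> A. w \<bullet> v e = 0}))"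
proof -
  define c where "c = (\<Sum>e\<in>A. sgn (w \<bullet> v e) *\<^sub>R v e)"
  define K where "K = (+) (- c) ` zonotope_face A v w"
  let ?T = "v ` {e \<in> A. w \<bullet> v e = 0}"
  have "c \<in> affine hull zonotope_face A v w"
    unfolding c_def by (intro hull_inc center_in_zonotope_face)
  then have "aff_dim (zonotope_face A v w) = int (dim K)"
    unfolding K_def by (rule aff_dim_eq_dim)
  moreover have "K \<subseteq> span ?T"
  proof
    fix x assume "x \<in> K"
    then obtain t where x: "x = - c + (\<Sum>e\<in>A. t e *\<^sub>R v e)"
      and t: "\<And>e. e \<in> A \<Longrightarrow> w \<bullet> v e \<noteq> 0 \<Longrightarrow> t e = sgn (w \<bullet> v e)"
      by (auto simp: K_def zonotope_face_def)
    have "x = (\<Sum>e\<in>A. (t e - sgn (w \<bullet> v e)) *\<^sub>R v e)"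
      unfolding x c_def by (simp add: scaleR_left_diff_distrib sum_subtractf)
    also have "\<dots> \<in> span ?T"
    proof (rule span_sum)
      fix e assume "e \<in> A"
      then show "(t e - sgn (w \<bullet> v e)) *\<^sub>R v e \<in> span ?T"
        using t[of e] by (cases "w \<bullet> v e = 0") (auto intro!: span_scale[OF span_base] simp: span_zero)
    qed
    finally show "x \<in> span ?T" .
  qed
  moreover have "?T \<subseteq> span K"
  proof
    fix x assume "x \<in> ?T"
    then obtain e where e: "e \<in> A" "w \<bullet> v e = 0" "x = v e" by auto
    \<comment> \<open>This changes the center only at \<open>e\<close>, from coefficient 0 to 1, so
      the difference from the center is \<open>v e\<close>.\<close>
    define t where "t = (\<lambda>e'. if e' = e then 1 else sgn (w \<bullet> v e'))"
    have "(\<Sum>e\<in>A. t e *\<^sub>R v e) \<in> zonotope_face A v w"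
      unfolding zonotope_face_def using e
      by (intro CollectI exI[of _ t] conjI refl ballI) (auto simp: t_def abs_sgn_eq)
    moreover have "- c + (\<Sum>e\<in>A. t e *\<^sub>R v e) = x"
    proof -
      have "- c + (\<Sum>e\<in>A. t e *\<^sub>R v e) = (\<Sum>e'\<in>A. (t e' - sgn (w \<bullet> v e')) *\<^sub>R v e')"
        by (simp add: c_def scaleR_left_diff_distrib sum_subtractf)
      also have "\<dots> = (\<Sum>e'\<in>A. if e' = e then v e else 0)"
        using e by (intro sum.cong) (auto simp: t_def)
      finally show ?thesis using e A by simp
    qed
    ultimately have "x \<in> K" unfolding K_def by force
    then show "x \<in> span K" by (rule span_base)
  qed
  ultimately show ?thesis using dim_mono[of K ?T] dim_mono[of ?T K] by simp
qed

text \<open>Faces are grouped by dimension. The empty face must be excluded: its dimension is -1,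
  which \<open>nat\<close> would turn into 0.\<close>

lemma f_polynomial_eq_sum_faces:
  assumes "polytope P"
  shows "f_polynomial P = (\<Sum>F | F face_of P \<and> F \<noteq> {}. monom 1 (nat (aff_dim F)))"
proof -
  let ?S = "{F. F face_of P \<and> F \<noteq> {}}"
  have fin: "finite ?S"
    using finite_polytope_faces[OF assms] by (rule rev_finite_subset) auto
  have "f_polynomial P = (\<Sum>i=0..nat (aff_dim P). \<Sum>F\<in>{F \<in> ?S. nat (aff_dim F) = i}. monom 1 (nat (aff_dim F)))"
    unfolding f_polynomial_def
  proof (rule sum.cong)
    fix i
    have "aff_dim F = int i \<longleftrightarrow> F \<noteq> {} \<and> nat (aff_dim F) = i" for F :: "'a set"
      using aff_dim_geq[of F] aff_dim_empty[of F] by auto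
    then have "f_number P i = card {F \<in> ?S. nat (aff_dim F) = i}"
      unfolding f_number_def by (intro arg_cong[of _ _ card]) auto
    moreover have "(\<Sum>F\<in>{F \<in> ?S. nat (aff_dim F) = i}. monom 1 (nat (aff_dim F))) =
        (\<Sum>F\<in>{F \<in> ?S. nat (aff_dim F) = i}. monom (1 :: real) i)"
      by (rule sum.cong) auto
    ultimately show "monom (of_nat (f_number P i)) i =
        (\<Sum>F\<in>{F \<in> ?S. nat (aff_dim F) = i}. monom (1 :: real) (nat (aff_dim F)))"
      by (simp add: of_nat_monom[symmetric] of_nat_poly smult_monom)
  qed simp
  also have "\<dots> = (\<Sum>F\<in>?S. monom 1 (nat (aff_dim F)))"
  proof (rule sum.group[OF fin])
    show "(\<lambda>F. nat (aff_dim F)) ` ?S \<subseteq> {0..nat (aff_dim P)}"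
      by (auto intro!: nat_mono aff_dim_subset face_of_imp_subset)
  qed simp
  finally show ?thesis by simp
qed

subsection \<open>The span of root vectors\<close>

definition root_vector :: "'n \<times> 'n \<Rightarrow> real ^ 'n::finite" where
  "root_vector e = axis (fst e) 1 - axis (snd e) 1"

lemma inner_root_vector: "w \<bullet> root_vector e = w $ fst e - w $ snd e"
  by (simp add: root_vector_def inner_diff_right inner_axis)

text \<open>The orthogonal complement of the span is the space \<open>N\<close> of vectors that are
  constant on the components of the graph with edge set \<open>A\<close>. The indicator vectors of
  the components form an orthogonal basis of \<open>N\<close>.\<close>

lemma dim_root_vectors:
  fixes A :: "('n::finite \<times> 'n) set"
  shows "dim (root_vector ` A) + card (UNIV // (A \<union> A\<inverse>)\<^sup>*) = CARD('n)"
proof -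
  define r where "r = (A \<union> A\<inverse>)\<^sup>*"
  define Q where "Q = UNIV // r"
  let ?V = "root_vector ` A"
  let ?ind = "\<lambda>C. (\<chi> i. if i \<in> C then 1 else 0) :: real ^ 'n"
  define N where "N = {y :: real ^ 'n. \<forall>(i, j)\<in>A. y $ i = y $ j}"
  have equiv: "equiv UNIV r"
    unfolding r_def by (rule equiv_rtrancl) (auto simp: sym_def)
  have disj: "C = D" if "C \<in> Q" "D \<in> Q" "x \<in> C" "x \<in> D" for C D x
    using quotient_disj[OF equiv, of C D] that by (auto simp: Q_def)
  have ne: "C \<noteq> {}" if "C \<in> Q" for C
    using in_quotient_imp_non_empty[OF equiv] that by (auto simp: Q_def)
  have inj: "inj_on ?ind Q"
    by (rule inj_onI) (auto simp: vec_eq_iff split: if_splits)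
  have "?ind ` Q \<subseteq> N"
  proof -
    have "i \<in> C \<longleftrightarrow> j \<in> C" if "(i, j) \<in> A" "C \<in> Q" for i j C
    proof -
      have "(i, j) \<in> r" "(j, i) \<in> r" using that by (auto simp: r_def)
      then show ?thesis
        using in_quotient_imp_closed[OF equiv, of C] that by (auto simp: Q_def)
    qed
    then show ?thesis by (auto simp: N_def)
  qed
  moreover have "N \<subseteq> span (?ind ` Q)"
  proof
    fix y assume "y \<in> N"
    have const: "y $ i = y $ j" if "(i, j) \<in> r" for i j
      using that unfolding r_def
      by (induction rule: rtrancl_induct) (use \<open>y \<in> N\<close> in \<open>auto simp: N_def\<close>)
    \<comment> \<open>The choice of representative is immaterial, as \<open>y\<close> is constant on
      each class.\<close>
    define g where "g C = y $ (SOME i. i \<in> C)" for C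
    have g: "g C = y $ i" if "C \<in> Q" "i \<in> C" for C i
    proof -
      have "(SOME i. i \<in> C) \<in> C" using that(2) by (rule someI)
      then show ?thesis
        using in_quotient_imp_in_rel[OF equiv, of C] that const unfolding g_def by (auto simp: Q_def)
    qed
    have "y = (\<Sum>C\<in>Q. g C *\<^sub>R ?ind C)"
    proof (rule vec_eq_iff[THEN iffD2], rule allI)
      fix k
      have "k \<in> \<Union>Q" using Union_quotient[OF equiv] by (simp add: Q_def)
      then obtain D where D: "D \<in> Q" "k \<in> D" by blast
      have "(\<Sum>C\<in>Q. g C *\<^sub>R ?ind C) $ k = (\<Sum>C\<in>Q. if C = D then g D else 0)"
        using D disj unfolding sum_component by (intro sum.cong) auto
      also have "\<dots> = y $ k" using D g by simp
      finally show "y $ k = (\<Sum>C\<in>Q. g C *\<^sub>R ?ind C) $ k" by simp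
    qed
    also have "\<dots> \<in> span (?ind ` Q)"
      by (intro span_sum span_scale span_base) auto
    finally show "y \<in> span (?ind ` Q)" .
  qed
  moreover have "independent (?ind ` Q)"
  proof (rule pairwise_orthogonal_independent)
    show "pairwise orthogonal (?ind ` Q)"
    proof (rule pairwiseI)
      fix x y assume xy: "x \<in> ?ind ` Q" "y \<in> ?ind ` Q" "x \<noteq> y"
      then obtain C D where "C \<in> Q" "D \<in> Q" "C \<noteq> D" "x = ?ind C" "y = ?ind D" by auto
      moreover from this have "i \<notin> C \<or> i \<notin> D" for i using disj by blast
      ultimately show "orthogonal x y"
        by (auto simp: orthogonal_def inner_vec_def intro!: sum.neutral split: if_splits)
    qed
    show "0 \<notin> ?ind ` Q"
    proof
      assume "0 \<in> ?ind ` Q"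
      then obtain C where "C \<in> Q" "?ind C = 0" by force
      then show False using ne[of C] by (auto simp: vec_eq_iff split: if_splits)
    qed
  qed
  ultimately have "dim N = card (?ind ` Q)"
    by (intro dim_unique) auto
  then have dimN: "dim N = card Q" by (simp add: card_image[OF inj])
  have "{y \<in> UNIV. \<forall>x\<in>span ?V. orthogonal x y} = N"
  proof -
    have "(\<forall>x\<in>span ?V. orthogonal x y) \<longleftrightarrow> (\<forall>x\<in>?V. orthogonal x y)" for y
      using orthogonal_to_span[of _ ?V y] by (metis orthogonal_commute span_base)
    also have "\<dots> y \<longleftrightarrow> y \<in> N" for y
      by (auto simp: N_def orthogonal_def inner_commute[of _ y] inner_root_vector)
    finally show ?thesis by simp
  qed
  with dim_subspace_orthogonal_to_vectors[of "span ?V" UNIV]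
  have "dim N + dim (span ?V) = dim (UNIV :: (real ^ 'n) set)"
    by (simp add: subspace_span)
  then show ?thesis by (simp add: dimN Q_def r_def)
qed

subsection \<open>The chromatic polynomial and the graphical zonotope\<close>

text \<open>The factors -1 - i for i < k multiply to (-1)^k k!, and the factorial cancels.\<close>

lemma poly_binomial_poly_minus_one: "poly (binomial_poly k) (-1) = (-1) ^ k"
proof -
  have *: "(\<Prod>i<k. poly [:- of_nat i, 1:] (-1)) = (-1) ^ k * (of_nat (fact k) :: real poly)"
    by (induction k) (simp_all add: algebra_simps)
  have "poly (binomial_poly k) (-1) = [:1 / fact k:] * ((-1) ^ k * of_nat (fact k))"
    by (simp only: binomial_poly_def poly_smult poly_prod *)
  also have "\<dots> = ([:1 / fact k:] * of_nat (fact k)) * (-1) ^ k"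
    by (simp only: mult_ac)
  also have "[:1 / fact k:] * (of_nat (fact k) :: real poly) = 1"
    by (simp add: of_nat_poly one_pCons)
  finally show ?thesis by simp
qed

lemma monom_sum: "monom (\<Sum>x\<in>A. f x) k = (\<Sum>x\<in>A. monom (f x) k)"
  by (induction A rule: infinite_finite_induct) (simp_all flip: add_monom)

lemma pcompose_monom_minus_X: "pcompose (monom c k) [:0, -1:] = monom (c * (-1) ^ k) k"
  for c :: "'a::comm_ring_1"
  by (induction k arbitrary: c) (simp_all add: monom_Suc pcompose_pCons monom_0 flip: minus_monom)

text \<open>At d = -1 the binomial coefficients become signs that depend only on the number of
  blocks, so the sums over k merge into one sum over all ordered set partitions.\<close>

lemma poly_q_chromatic_poly_minus_one:
  assumes "finite (verts G)" "verts G \<noteq> {}"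
  shows "poly (q_chromatic_poly G) (-1) =
    (\<Sum>Is\<in>set_compositions (verts G). monom ((-1) ^ length Is) (\<Sum>I\<leftarrow>Is. graph_rank (G \<restriction> I)))"
proof -
  let ?V = "verts G" and ?rk = "\<lambda>Is. \<Sum>I\<leftarrow>Is. graph_rank (G \<restriction> I)"
  have osp: "ordered_set_partitions ?V k = {Is \<in> set_compositions ?V. length Is = k}" for k
    by (auto simp: ordered_set_partitions_def set_compositions_def)
  have "poly (q_chromatic_poly G) (-1) =
      (\<Sum>k=1..card ?V. (\<Sum>Is\<in>ordered_set_partitions ?V k. monom 1 (?rk Is)) * (-1) ^ k)"
    by (simp add: q_chromatic_poly_def poly_sum poly_binomial_poly_minus_one)
  also have "\<dots> = (\<Sum>k=1..card ?V. \<Sum>Is | Is \<in> set_compositions ?V \<and> length Is = k. monom ((-1) ^ length Is) (?rk Is))"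
  proof (rule sum.cong)
    fix k
    have "monom 1 (?rk Is) * (-1) ^ length Is = (monom ((-1) ^ length Is) (?rk Is) :: real poly)" for Is
    proof -
      have "(-1 :: real poly) ^ length Is = [:(-1) ^ length Is:]"
        by (induction Is) (simp_all add: one_pCons)
      then show ?thesis by (simp add: smult_monom)
    qed
    then show "(\<Sum>Is\<in>ordered_set_partitions ?V k. monom 1 (?rk Is)) * (-1) ^ k =
        (\<Sum>Is | Is \<in> set_compositions ?V \<and> length Is = k. monom ((-1) ^ length Is :: real) (?rk Is))"
      unfolding osp sum_distrib_right by (intro sum.cong) auto
  qed simp
  also have "\<dots> = (\<Sum>Is\<in>set_compositions ?V. monom ((-1) ^ length Is) (?rk Is))"
  proof (rule sum.group)
    \<comment> \<open>The lower bound 1 is right because a nonempty vertex set has no partition into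
      zero blocks.\<close>
    show "length ` set_compositions ?V \<subseteq> {1..card ?V}"
    proof
      fix k assume "k \<in> length ` set_compositions ?V"
      then obtain Is where "Is \<in> set_compositions ?V" "k = length Is" by auto
      then show "k \<in> {1..card ?V}"
        using assms length_set_composition_le[of ?V Is] by (cases Is) auto
    qed
  qed (use assms finite_set_compositions in auto)
  finally show ?thesis .
qed

section \<open>Faces of the graphical zonotope and their fibers\<close>

context
  fixes G :: "('n::{finite,linorder}, 'b) pre_digraph"
  assumes graph: "graph G"
begin

interpretation graph G by (rule graph)

definition pos_edges :: "('n \<times> 'n) set" where
  "pos_edges = {(i, j). (i, j) \<in> arcs_ends G \<and> i < j}"

lemma graphical_zonotope_eq: "graphical_zonotope G = zonotope pos_edges root_vector"
  unfolding graphical_zonotope_def zonotope_def pos_edges_def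
  by (rule sum.cong) (auto simp: root_vector_def)

text \<open>The generators use one orientation of each edge. Passing to both is harmless, since
  reversing an arc negates both signs.\<close>

lemma graphical_face_eq_iff:
  "zonotope_face pos_edges root_vector w = zonotope_face pos_edges root_vector w' \<longleftrightarrow>
    same_signs (arcs_ends G) (($) w) (($) w')"
proof -
  have "zonotope_face pos_edges root_vector w = zonotope_face pos_edges root_vector w' \<longleftrightarrow>
      (\<forall>(i, j)\<in>pos_edges. sgn (w $ i - w $ j) = sgn (w' $ i - w' $ j))"
    by (auto simp: zonotope_face_eq_iff inner_root_vector)
  also have "\<dots> \<longleftrightarrow> same_signs (arcs_ends G) (($) w) (($) w')"
    unfolding same_signs_def
  proof (intro iffI; clarify)
    fix i j
    assume *: "\<forall>(i, j)\<in>pos_edges. sgn (w $ i - w $ j) = sgn (w' $ i - w' $ j)" and ij: "(i, j) \<in> arcs_ends G"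
    then have ji: "(j, i) \<in> arcs_ends G" by (rule_tac graph_symmetric)
    have flip: "sgn (x $ i - x $ j) = - sgn (x $ j - x $ i)" for x :: "(real, 'n) vec"
      by (metis minus_diff_eq sgn_minus)
    show "sgn (w $ i - w $ j) = sgn (w' $ i - w' $ j)"
    proof (cases i j rule: linorder_cases)
      case less
      then show ?thesis using * ij by (auto simp: pos_edges_def)
    next
      case greater
      then show ?thesis using * ji unfolding flip by (auto simp: pos_edges_def)
    qed simp
  qed (auto simp: pos_edges_def)
  finally show ?thesis .
qed

text \<open>The generators orthogonal to \<open>w\<close> are those of the tied edges, and with both
  orientations these edges form the relation \<open>tied\<close>, so \<open>dim_root_vectors\<close>
  applies.\<close>

lemma aff_dim_graphical_face:
  "nat (aff_dim (zonotope_face pos_edges root_vector w)) + card (UNIV // (tied (arcs_ends G) (($) w))\<^sup>*) = CARD('n)"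
proof -
  let ?A = "{e \<in> pos_edges. w \<bullet> root_vector e = 0}"
  have A: "?A = {(i, j) \<in> pos_edges. w $ i = w $ j}"
    by (auto simp: inner_root_vector)
  have "(i, j) \<in> tied (arcs_ends G) (($) w) \<longleftrightarrow> (i, j) \<in> ?A \<union> ?A\<inverse>" for i j
    using adj_not_same[of i] graph_symmetric[of i j] graph_symmetric[of j i]
    unfolding A by (cases i j rule: linorder_cases) (auto simp: pos_edges_def tied_def)
  then have "tied (arcs_ends G) (($) w) = ?A \<union> ?A\<inverse>" by auto
  then show ?thesis
    using dim_root_vectors[of ?A] by (simp add: aff_dim_zonotope_face)
qed

text \<open>The fiber of a face under the map from ordered set partitions to faces consists of the
  partitions compatible with \<open>w\<close>, to which the signed count applies with all tie
  classes as \<open>Q\<close>.\<close>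

lemma signed_count_face_fiber:
  "(\<Sum>Is | Is \<in> set_compositions UNIV \<and>
      zonotope_face pos_edges root_vector (\<chi> i. real (block_index Is i)) = zonotope_face pos_edges root_vector w.
      (-1) ^ length Is) =
    ((-1) ^ card (UNIV // (tied (arcs_ends G) (($) w))\<^sup>*) :: real)"
proof -
  have sym: "sym (arcs_ends G)" using graph_symmetric by (auto simp: sym_def)
  let ?Q = "UNIV // (tied (arcs_ends G) (($) w))\<^sup>*"
  have U: "\<Union>?Q = UNIV"
    by (rule Union_quotient[OF equiv_rtrancl[OF sym_tied[OF sym]]])
  have "{Is. Is \<in> set_compositions UNIV \<and>
      zonotope_face pos_edges root_vector (\<chi> i. real (block_index Is i)) = zonotope_face pos_edges root_vector w} =
      compat_compositions (arcs_ends G) (($) w) (\<Union>?Q)"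
    by (simp add: graphical_face_eq_iff compat_compositions_def U same_signs_def)
  then show ?thesis
    using signed_count_compat_compositions[OF sym, of ?Q "($) w"] by simp
qed

text \<open>Each face in the f-polynomial is replaced by the signed sum over its fiber, and the
  fibers together exhaust the ordered set partitions.\<close>

lemma f_polynomial_graphical_zonotope:
  assumes V: "verts G = UNIV"
  shows "f_polynomial (graphical_zonotope G) =
    (-1) ^ CARD('n) * pcompose (poly (q_chromatic_poly G) (-1)) [:0, -1:]"
proof -
  let ?\<phi> = "zonotope_face pos_edges root_vector :: (real, 'n) vec \<Rightarrow> _"
  let ?S = "set_compositions (UNIV :: 'n set)"
  define face where "face Is = ?\<phi> (\<chi> i. real (block_index Is i))" for Is
  define d where "d F = nat (aff_dim F)" for F :: "(real, 'n) vec set"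
  \<comment> \<open>Both sides complement the same number of tie classes to the number of
    vertices.\<close>
  have rank: "(\<Sum>I\<leftarrow>Is. graph_rank (G \<restriction> I)) = d (face Is)" if "Is \<in> ?S" for Is
    using sum_graph_rank_add_card[OF V that] aff_dim_graphical_face[of "\<chi> i. real (block_index Is i)"]
    by (simp add: d_def face_def comp_def vec_lambda_inverse)
  have fin: "finite (range ?\<phi>)"
    unfolding faces_of_zonotope[OF finite, symmetric]
    using finite_polytope_faces[OF polytope_zonotope[OF finite]] by (rule rev_finite_subset) auto
  \<comment> \<open>The three parts of the exponent come from the factor in front, from d = -1, and
    from replacing q by -q. The signed count turns the middle part into the number of tie classes,
    which together with \<open>d F\<close> gives \<open>CARD('n)\<close>, so the total sign is
    +1.\<close>
  have one_fiber: "(\<Sum>Is | Is \<in> ?S \<and> face Is = F. monom ((-1) ^ (CARD('n) + length Is + d F)) (d F)) = monom (1 :: real) (d F)"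
    if F: "F \<in> range ?\<phi>" for F
  proof -
    obtain w where w: "F = ?\<phi> w" using F by auto
    let ?c = "card (UNIV // (tied (arcs_ends G) (($) w))\<^sup>*)"
    have "(\<Sum>Is | Is \<in> ?S \<and> face Is = F. monom ((-1) ^ (CARD('n) + length Is + d F)) (d F)) =
        monom ((-1) ^ (CARD('n) + d F) * (\<Sum>Is | Is \<in> ?S \<and> face Is = F. (-1 :: real) ^ length Is)) (d F)"
      by (simp add: monom_sum power_add sum_distrib_left mult_ac)
    also have "(\<Sum>Is | Is \<in> ?S \<and> face Is = F. (-1 :: real) ^ length Is) = (-1) ^ ?c"
      unfolding face_def w by (rule signed_count_face_fiber)
    also have "(-1) ^ (CARD('n) + d F) * (-1) ^ ?c = (1 :: real)"
    proof -
      have "d F + ?c = CARD('n)" using aff_dim_graphical_face[of w] by (simp add: w d_def)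
      then have "(-1) ^ (CARD('n) + d F) * (-1) ^ ?c = (-1 :: real) ^ (CARD('n) + CARD('n))"
        by (simp only: power_add[symmetric] add.assoc)
      then show ?thesis by simp
    qed
    finally show ?thesis .
  qed
  have "f_polynomial (graphical_zonotope G) = (\<Sum>F\<in>range ?\<phi>. monom 1 (d F))"
    unfolding graphical_zonotope_eq d_def
    by (simp add: f_polynomial_eq_sum_faces polytope_zonotope faces_of_zonotope)
  also have "\<dots> = (\<Sum>F\<in>range ?\<phi>. \<Sum>Is | Is \<in> ?S \<and> face Is = F. monom ((-1) ^ (CARD('n) + length Is + d (face Is))) (d (face Is)))"
    by (intro sum.cong refl, subst one_fiber[symmetric]) (auto intro: sum.cong)
  also have "\<dots> = (\<Sum>Is\<in>?S. monom ((-1) ^ (CARD('n) + length Is + d (face Is))) (d (face Is)))"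
    using fin by (intro sum.group) (auto simp: finite_set_compositions face_def)
  also have "\<dots> = (-1) ^ CARD('n) * (\<Sum>Is\<in>?S. monom ((-1) ^ (length Is + d (face Is))) (d (face Is)))"
  proof -
    have "(-1) ^ CARD('n) * monom c k = monom ((-1) ^ CARD('n) * c) k" for c :: real and k
      by (cases "even CARD('n)") (simp_all add: minus_monom)
    then show ?thesis by (simp only: sum_distrib_left power_add mult.assoc)
  qed
  also have "(\<Sum>Is\<in>?S. monom ((-1) ^ (length Is + d (face Is))) (d (face Is))) =
      pcompose (poly (q_chromatic_poly G) (-1)) [:0, -1:]"
    using V by (simp add: poly_q_chromatic_poly_minus_one pcompose_sum pcompose_monom_minus_X rank power_add)
  finally show ?thesis .
qed

end

theorem theorem1:
  fixes \<Gamma> :: "('n::{finite,linorder}, 'b) pre_digraph"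
  assumes "graph \<Gamma>"
    and "Digraph_Component.connected \<Gamma>"
    and "verts \<Gamma> = UNIV"
  shows "f_polynomial (graphical_zonotope \<Gamma>) =
    (-1) ^ card (verts \<Gamma>) * pcompose (poly (q_chromatic_poly \<Gamma>) (-1)) [:0, -1:]"
  using f_polynomial_graphical_zonotope[OF assms(1,3)] assms(3) by simp

end
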